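(* Let $A\in M_R$ be a reciprocal pairwise comparison matrix of order $n$. Then $A\in M_C$ (i.e. $A$ is consistent) if and only if $KII(A)=0$.
   Context: $M_R$ is the set of all real $n\times n$ matrices $A=(a_{ij})$ with $a_{ij}>0$ for all $i,j$ and $a_{ij}=1/a_{ji}$ for all $i,j$ (reciprocal matrices). $M_C$ is the set of all real $n\times n$ matrices with $a_{ij}>0$ for all $i,j$ and $a_{ij}a_{jk}=a_{ik}$ for all $i,j,k$ (consistent matrices). Koczkodaj's inconsistency index of $A\in M_R$ is $$KII(A)=\max_{i,j,k\in\{1,\dots,n\}}\ \min\left(\left|1-\frac{a_{ik}}{a_{ij}a_{jk}}\right|,\ \left|1-\frac{a_{ij}a_{jk}}{a_{ik}}\right|\right).$$ *)

theory Defs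
  imports "HOL-Analysis.Analysis"
begin

definition reciprocal_matrices :: "(real ^ 'n ^ 'n) set" where
  "reciprocal_matrices =
    {A. (\<forall>i j. A $ i $ j > 0) \<and> (\<forall>i j. A $ i $ j = 1 / A $ j $ i)}"

definition consistent_matrices :: "(real ^ 'n ^ 'n) set" where
  "consistent_matrices =
    {A. (\<forall>i j. A $ i $ j > 0) \<and> (\<forall>i j k. A $ i $ j * A $ j $ k = A $ i $ k)}"

text \<open>Koczkodaj's inconsistency index. The maximum is over a finite nonempty set, since the
  index type is finite and inhabited; triples with repeated indices are included.\<close>

definition KII :: "real ^ 'n ^ 'n \<Rightarrow> real" where
  "KII A = (MAX (i, j, k) \<in> UNIV.
     min \<bar>1 - A $ i $ k / (A $ i $ j * A $ j $ k)\<bar>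
         \<bar>1 - (A $ i $ j * A $ j $ k) / A $ i $ k\<bar>)"

end

theory Submission
  imports Defs
begin

text \<open>The index is a maximum of finitely many nonnegative numbers, so it vanishes exactly when
  each of them does (\<open>Max_image_eq_0_iff\<close>). For positive entries, the term of a triple
  vanishes exactly when the two quantities compared in it agree
  (\<open>min_abs_ratio_eq_0_iff\<close>), which is the consistency equation for that
  triple.\<close>

lemma Max_image_eq_0_iff:
  fixes f :: "'a \<Rightarrow> 'b::{linorder, zero}"
  assumes "finite S" "S \<noteq> {}" "\<And>x. x \<in> S \<Longrightarrow> 0 \<le> f x"
  shows "Max (f ` S) = 0 \<longleftrightarrow> (\<forall>x\<in>S. f x = 0)"
proof -
  have "Max (f ` S) = 0 \<longleftrightarrow> 0 \<in> f ` S \<and> (\<forall>y\<in>f ` S. y \<le> 0)"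
    using assms by (intro Max_eq_iff) auto
  also have "\<dots> \<longleftrightarrow> (\<forall>x\<in>S. f x = 0)"
  proof
    assume "0 \<in> f ` S \<and> (\<forall>y\<in>f ` S. y \<le> 0)"
    then show "\<forall>x\<in>S. f x = 0"
      using assms(3) by (blast intro: antisym)
  next
    assume "\<forall>x\<in>S. f x = 0"
    \<comment> \<open>A point of \<open>S\<close> is what makes 0 an attained value.\<close>
    moreover obtain x where "x \<in> S"
      using assms(2) by blast
    ultimately show "0 \<in> f ` S \<and> (\<forall>y\<in>f ` S. y \<le> 0)"
      by (metis imageE image_eqI order_refl)
  qed
  finally show ?thesis .
qed

text \<open>A ratio of positive numbers is 1 iff its inverse is, so both arguments of
  \<open>min\<close> vanish together, whichever is the smaller.\<close>

lemma min_abs_ratio_eq_0_iff: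
  fixes x y :: real
  assumes "x > 0" "y > 0"
  shows "min \<bar>1 - x / y\<bar> \<bar>1 - y / x\<bar> = 0 \<longleftrightarrow> y = x"
proof -
  have "\<bar>1 - x / y\<bar> = 0 \<longleftrightarrow> y = x" "\<bar>1 - y / x\<bar> = 0 \<longleftrightarrow> y = x"
    using assms by (auto simp: field_simps)
  then show ?thesis
    by (simp only: min_def split: if_split) auto
qed

theorem proposition12:
  fixes A :: "real ^ 'n ^ 'n"
  assumes "A \<in> reciprocal_matrices"
  shows "A \<in> consistent_matrices \<longleftrightarrow> KII A = 0"
proof -
  have pos: "A $ i $ j > 0" for i j
    using assms unfolding reciprocal_matrices_def by blast
  have "KII A = 0 \<longleftrightarrow> (\<forall>i j k. min \<bar>1 - A $ i $ k / (A $ i $ j * A $ j $ k)\<bar>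
      \<bar>1 - (A $ i $ j * A $ j $ k) / A $ i $ k\<bar> = 0)"
    unfolding KII_def by (subst Max_image_eq_0_iff) (simp_all add: split_paired_all)
  also have "\<dots> \<longleftrightarrow> (\<forall>i j k. A $ i $ j * A $ j $ k = A $ i $ k)"
    \<comment> \<open>Here \<open>x\<close> is \<open>A $ i $ k\<close> and \<open>y\<close> is the
      product \<open>A $ i $ j * A $ j $ k\<close>, positive as a product of positive
      entries.\<close>
    by (simp only: min_abs_ratio_eq_0_iff pos mult_pos_pos)
  finally show ?thesis
    using pos by (simp add: consistent_matrices_def)
qed

end
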